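(* Assume A1, A2 and A3 (stated in the context). Let $\delta>0$, $y^\delta\in Y$ with $\|y^\delta-y\|\le\delta$, $\tau>\frac{1+\eta}{1-\eta}$ and $\theta_k\in(0,2)$. Suppose $x_k^\delta\in B_\rho(x_0)$ and $\|F_\delta(x_k^\delta)\|>\tau\delta$ (in which case $F'(x_k^\delta)^*F_\delta(x_k^\delta)\ne0$), and let $$x_{k+1}^\delta:=x_k^\delta-\theta_k\frac{p_\delta(\|F_\delta(x_k^\delta)\|)}{\|F'(x_k^\delta)^*F_\delta(x_k^\delta)\|^2}F'(x_k^\delta)^*F_\delta(x_k^\delta),\qquad p_\delta(t):=t\big((1-\eta)t-(1+\eta)\delta\big).$$ Then, for all $x^\star\in B_\rho(x_0)\cap F^{-1}(y)$, $$\|x^\star-x_k^\delta\|^2\ \ge\ \|x^\star-x_{k+1}^\delta\|^2+\theta_k(2-\theta_k)\left(\frac{p_\delta(\|F_\delta(x_k^\delta)\|)}{\|F'(x_k^\delta)^*F_\delta(x_k^\delta)\|}\right)^2.$$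
   Context: $X,Y$ are real Hilbert spaces, $F:D(F)\subset X\to Y$ is a (nonlinear) operator, $y\in Y$ is the exact data, $F_\delta(x):=F(x)-y^\delta$, and $F^{-1}(y)=\{x\in D(F):F(x)=y\}$. $B_r(z)$ denotes the open ball of radius $r$ centered at $z$ in $X$. A1: $F$ is continuous on $D(F)$, which has nonempty interior; there are constants $C,\rho>0$ and $x_0\in D(F)$ with $B_\rho(x_0)\subset D(F)$ such that the Gateaux derivative $F'(x)$ (a bounded linear operator $X\to Y$) exists for $x\in B_\rho(x_0)$ and $\|F'(x)\|\le C$ there. A2 (tangential cone condition): there is a constant $\eta\in[0,1)$ such that $\|F(\bar x)-F(x)-F'(x)(\bar x-x)\|\le\eta\|F(\bar x)-F(x)\|$ for all $x,\bar x\in B_\rho(x_0)$. A3: there is $x^\star\in B_{\rho/2}(x_0)$ with $F(x^\star)=y$. *)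

theory Defs
  imports "HOL-Analysis.Analysis"
begin

text \<open>
  Real Hilbert spaces are rendered as types of sort \<open>{real_inner, complete_space}\<close>.
  An operator \<open>F : D(F) \<rightarrow> Y\<close> is a total function together with a domain set \<open>D\<close>; its values
  outside \<open>D\<close> are irrelevant.
\<close>

text \<open>
  The Gateaux derivative is a bounded linear operator whose values are the two-sided
  directional derivatives. It is only meant for \<open>x\<close> in the interior of the domain of \<open>F\<close>,
  where \<open>x + t *\<^sub>R h\<close> lies in the domain for all small \<open>t\<close>.
\<close>

definition has_gateaux_derivative ::
  "('a::real_normed_vector \<Rightarrow> 'b::real_normed_vector) \<Rightarrow> ('a \<Rightarrow>\<^sub>L 'b) \<Rightarrow> 'a \<Rightarrow> bool"
  where "has_gateaux_derivative F L x \<longleftrightarrow>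
    (\<forall>h. ((\<lambda>t::real. (F (x + t *\<^sub>R h) - F x) /\<^sub>R t) \<longlongrightarrow> blinfun_apply L h) (at 0))"

definition residual :: "('a \<Rightarrow> 'b::real_normed_vector) \<Rightarrow> 'b \<Rightarrow> 'a \<Rightarrow> 'b"
  where "residual F yd x = F x - yd"

definition p_poly :: "real \<Rightarrow> real \<Rightarrow> real \<Rightarrow> real"
  where "p_poly \<eta> \<delta> t = t * ((1 - \<eta>) * t - (1 + \<eta>) * \<delta>)"

text \<open>
  The Hilbert space adjoint, applied to the residual. The constant \<^const>\<open>adjoint\<close> is a
  choice operator over the defining identity; for a bounded linear operator on a real Hilbert
  space it is the usual adjoint, by the Riesz representation theorem.
\<close>

definition adj_residual ::
  "('a::{real_inner,complete_space} \<Rightarrow> 'b::{real_inner,complete_space}) \<Rightarrow>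
   ('a \<Rightarrow> 'a \<Rightarrow>\<^sub>L 'b) \<Rightarrow> 'b \<Rightarrow> 'a \<Rightarrow> 'a"
  where "adj_residual F F' yd x = adjoint (blinfun_apply (F' x)) (residual F yd x)"

end

theory Submission imports Defs begin

text \<open>
  Pairing the adjoint residual with \<open>xk - xs\<close> moves the derivative onto \<open>xk - xs\<close>, where the
  tangential cone condition and the noise bound show that the inner product is at least
  \<open>p_poly \<eta> \<delta>\<close> of the residual norm; the discrepancy makes this positive. So \<open>xs\<close> lies in a half
  space bounded by a hyperplane orthogonal to the adjoint residual, and the update is a relaxed
  projection onto that half space, which is Fejer monotone.
\<close>

text \<open>The representing vector minimises \<open>(norm x)\<^sup>2 - 2 * f x\<close>.\<close>

lemma riesz_representation:
  fixes f :: "'a::{real_inner,complete_space} \<Rightarrow> real"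
  assumes "bounded_linear f"
  obtains z where "\<And>x. f x = inner x z"
proof -
  interpret f: bounded_linear f by fact
  obtain K where K: "\<And>x. norm (f x) \<le> norm x * K"
    using f.bounded by blast
  define J where "J x = (norm x)\<^sup>2 - 2 * f x" for x
  \<comment> \<open>Completing the square: \<open>J x\<close> is at least
    \<open>(norm x - K)\<^sup>2 - K\<^sup>2\<close>.\<close>
  have "- K\<^sup>2 \<le> J x" for x
  proof -
    have "f x \<le> norm x * K" using K[of x] by simp
    moreover have "0 \<le> (norm x - K)\<^sup>2" by simp
    ultimately show ?thesis by (simp add: J_def power2_diff)
  qed
  then have bdd: "bdd_below (range J)" by (intro bdd_belowI) auto
  define m where "m = Inf (range J)"
  have m_le: "m \<le> J x" for x
    unfolding m_def using bdd by (intro cInf_lower) auto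
  have "\<exists>x. J x < m + inverse (real (Suc n))" for n
    using cInf_lessD[of "range J" "m + inverse (real (Suc n))"] by (auto simp: m_def)
  then obtain X where X: "\<And>n. J (X n) < m + inverse (real (Suc n))" by metis
  \<comment> \<open>The midpoint of \<open>x\<close> and \<open>y\<close> also has
    \<open>J\<close>-value at least \<open>m\<close>, so by the parallelogram law two
    near-minimisers are close to each other. Every minimising sequence is therefore Cauchy.\<close>
  have parallelogram: "(dist x y)\<^sup>2 \<le> 2 * (J x - m) + 2 * (J y - m)" for x y
  proof -
    have "4 * J ((1/2) *\<^sub>R (x + y)) = (norm (x + y))\<^sup>2 - 4 * f x - 4 * f y"
      unfolding J_def norm_scaleR f.scaleR f.add
      by (simp add: power_mult_distrib power2_eq_square add_divide_distrib)
    moreover have "(norm (x + y))\<^sup>2 + (dist x y)\<^sup>2 = 2 * (norm x)\<^sup>2 + 2 * (norm y)\<^sup>2"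
      by (simp add: dist_norm power2_norm_eq_inner inner_simps)
    ultimately show ?thesis using m_le[of "(1/2) *\<^sub>R (x + y)"] by (simp add: J_def)
  qed
  have "Cauchy X"
  proof (rule metric_CauchyI)
    fix e :: real assume "0 < e"
    \<comment> \<open>Two gaps below \<open>e\<^sup>2 / 4\<close>, each doubled by
      \<open>parallelogram\<close>, add up to less than \<open>e\<^sup>2\<close>.\<close>
    then obtain N where N: "inverse (real (Suc N)) < e\<^sup>2 / 4"
      using reals_Archimedean[of "e\<^sup>2 / 4"] by auto
    have close: "J (X n) - m < e\<^sup>2 / 4" if "N \<le> n" for n
    proof -
      have "inverse (real (Suc n)) \<le> inverse (real (Suc N))"
        using that by (intro le_imp_inverse_le) auto
      with X[of n] N show ?thesis by linarith
    qed
    have "dist (X i) (X j) < e" if "N \<le> i" "N \<le> j" for i j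
    proof -
      have "(dist (X i) (X j))\<^sup>2 < e\<^sup>2"
        using parallelogram[of "X i" "X j"] close[OF that(1)] close[OF that(2)]
        by (simp add: field_simps)
      then show ?thesis using \<open>0 < e\<close> by (simp add: power2_less_imp_less)
    qed
    then show "\<exists>N. \<forall>i\<ge>N. \<forall>j\<ge>N. dist (X i) (X j) < e" by blast
  qed
  then obtain z where "X \<longlonglongrightarrow> z"
    using Cauchy_convergent_iff convergent_def by metis
  then have "(\<lambda>n. J (X n)) \<longlonglongrightarrow> J z"
    unfolding J_def by (intro tendsto_intros f.tendsto)
  moreover have "(\<lambda>n. m + inverse (real (Suc n))) \<longlonglongrightarrow> m + 0"
    by (intro tendsto_intros LIMSEQ_inverse_real_of_nat)
  ultimately have "J z \<le> m + 0"
    by (rule LIMSEQ_le) (use X less_imp_le in blast)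
  then have J_min: "J z \<le> J x" for x
    using m_le[of x] by linarith
  have "f h = inner h z" for h
  proof (cases "h = 0")
    case False
    \<comment> \<open>First-order condition at the minimiser: along \<open>h\<close>,
      \<open>J\<close> changes by the quadratic
      \<open>t\<^sup>2 * (norm h)\<^sup>2 + 2 * t * c\<close>. The chosen \<open>t\<close> is its
      vertex, where the value is negative unless \<open>c = 0\<close>.\<close>
    define c where "c = inner h z - f h"
    define t where "t = - c / (norm h)\<^sup>2"
    have "J (z + t *\<^sub>R h) = J z + (t\<^sup>2 * (norm h)\<^sup>2 + 2 * t * c)"
      unfolding J_def c_def power2_norm_eq_inner
      by (simp add: f.add f.scaleR inner_simps inner_commute algebra_simps power2_eq_square)
    also have "t\<^sup>2 * (norm h)\<^sup>2 + 2 * t * c = - (c\<^sup>2 / (norm h)\<^sup>2)"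
      using False by (simp add: t_def field_simps power2_eq_square)
    finally have "c\<^sup>2 / (norm h)\<^sup>2 \<le> 0"
      using J_min[of "z + t *\<^sub>R h"] by linarith
    then have "c = 0" using False by (simp add: divide_le_0_iff)
    then show ?thesis by (simp add: c_def)
  qed (simp add: f.zero)
  then show thesis by (rule that)
qed

text \<open>Since \<open>adjoint\<close> is a choice, its defining identity holds only once some
  adjoint exists. Riesz representation of \<open>inner (f x) y\<close> as a functional of
  \<open>x\<close>, for each fixed \<open>y\<close>, supplies one.\<close>

lemma adjoint_bounded_linear:
  fixes f :: "'a::{real_inner,complete_space} \<Rightarrow> 'b::real_inner"
  assumes "bounded_linear f"
  shows "inner x (adjoint f y) = inner (f x) y"
proof -
  have "\<exists>z. \<forall>x. inner (f x) y = inner x z" for y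
  proof -
    have "bounded_linear (\<lambda>x. inner (f x) y)"
      using assms by (intro bounded_linear_inner_left_comp)
    then show ?thesis by (metis riesz_representation)
  qed
  then have "\<exists>g. \<forall>x y. inner (f x) y = inner x (g y)" by metis
  then have "\<forall>x y. inner (f x) y = inner x (adjoint f y)"
    unfolding adjoint_def by (rule someI_ex)
  then show ?thesis by simp
qed

text \<open>The larger root of \<open>p_poly\<close> in \<open>t\<close> is
  \<open>(1 + \<eta>) / (1 - \<eta>) * \<delta>\<close>, and \<open>\<tau> * \<delta>\<close> lies
  beyond it.\<close>

lemma p_poly_pos:
  assumes "\<eta> < 1" "0 < \<delta>" "0 \<le> \<eta>" "(1 + \<eta>) / (1 - \<eta>) < \<tau>" "\<tau> * \<delta> < t"
  shows "0 < p_poly \<eta> \<delta> t"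
proof -
  have "(1 + \<eta>) / (1 - \<eta>) * \<delta> < t"
    using assms mult_strict_right_mono[of "(1 + \<eta>) / (1 - \<eta>)" \<tau> \<delta>] by linarith
  then have "(1 + \<eta>) * \<delta> < (1 - \<eta>) * t" using assms(1) by (simp add: field_simps)
  moreover have "0 < t"
  proof -
    have "0 \<le> (1 + \<eta>) / (1 - \<eta>) * \<delta>" using assms by simp
    with \<open>(1 + \<eta>) / (1 - \<eta>) * \<delta> < t\<close> show ?thesis by linarith
  qed
  ultimately show ?thesis by (simp add: p_poly_def)
qed

text \<open>The vector \<open>F' x (x - xs)\<close> splits into the residual \<open>r\<close>, the
  data error \<open>d\<close> and the linearisation error \<open>w\<close>. As
  \<open>F xs - F x\<close> is \<open>- (r + d)\<close>, the cone condition bounds \<open>w\<close>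
  by \<open>\<eta> * (norm r + \<delta>)\<close>. Pairing the sum with \<open>r\<close> and applying
  Cauchy-Schwarz to \<open>d + w\<close> leaves exactly \<open>p_poly\<close>.\<close>

lemma p_poly_le_inner_adj_residual:
  assumes "norm (F xs - F x - blinfun_apply (F' x) (xs - x)) \<le> \<eta> * norm (F xs - F x)"
    and "norm (yd - F xs) \<le> \<delta>" "0 \<le> \<eta>"
  shows "p_poly \<eta> \<delta> (norm (residual F yd x)) \<le> inner (x - xs) (adj_residual F F' yd x)"
proof -
  define r where "r = residual F yd x"
  define d where "d = yd - F xs"
  define w where "w = F xs - F x - blinfun_apply (F' x) (xs - x)"
  have "norm (F xs - F x) \<le> norm r + \<delta>"
    using norm_triangle_ineq[of r d] assms(2)
    by (simp add: r_def d_def residual_def norm_minus_commute)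
  then have "norm w \<le> \<eta> * (norm r + \<delta>)"
    using assms(1,3) mult_left_mono by (fastforce simp: w_def)
  then have "norm (d + w) \<le> \<delta> + \<eta> * (norm r + \<delta>)"
    using norm_triangle_ineq[of d w] assms(2) by (simp add: d_def)
  then have "norm (d + w) * norm r \<le> (\<delta> + \<eta> * (norm r + \<delta>)) * norm r"
    by (rule mult_right_mono) simp
  moreover have "- inner (d + w) r \<le> norm (d + w) * norm r"
    using Cauchy_Schwarz_ineq2[of "d + w" r] by linarith
  ultimately have "p_poly \<eta> \<delta> (norm r) \<le> inner r r + inner (d + w) r"
    by (simp add: p_poly_def power2_norm_eq_inner[symmetric] algebra_simps power2_eq_square)
  also have "\<dots> = inner (r + d + w) r"
    by (simp add: inner_simps)
  also have "r + d + w = blinfun_apply (F' x) (x - xs)"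
    by (simp add: r_def d_def w_def residual_def blinfun.diff_right)
  also have "inner \<dots> r = inner (x - xs) (adj_residual F F' yd x)"
    by (simp add: adj_residual_def r_def adjoint_bounded_linear blinfun.bounded_linear_right)
  finally show ?thesis by (simp add: r_def)
qed

text \<open>The number \<open>p / norm g\<close> is the distance from \<open>x\<close> to the half
  space of all \<open>z\<close> with \<open>p \<le> inner (x - z) g\<close>, and
  \<open>\<theta> = 1\<close> gives the projection onto it. Expanding the square, the cross term
  gains at least \<open>2 * \<theta>\<close> times the squared distance and the quadratic term costs
  \<open>\<theta>\<^sup>2\<close> times it.\<close>

lemma relaxed_projection_decrease:
  fixes g :: "'a::real_inner"
  assumes "g \<noteq> 0" "0 \<le> p" "p \<le> inner (x - xs) g" "0 \<le> \<theta>"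
  shows "(norm (xs - (x - (\<theta> * (p / (norm g)\<^sup>2)) *\<^sub>R g)))\<^sup>2 + \<theta> * (2 - \<theta>) * (p / norm g)\<^sup>2
    \<le> (norm (xs - x))\<^sup>2"
proof -
  define s where "s = \<theta> * (p / (norm g)\<^sup>2)"
  have "(norm (xs - (x - s *\<^sub>R g)))\<^sup>2
      = (norm (xs - x))\<^sup>2 - 2 * s * inner (x - xs) g + s\<^sup>2 * (norm g)\<^sup>2"
    unfolding power2_norm_eq_inner
    by (simp add: inner_simps inner_commute algebra_simps power2_eq_square)
  moreover have "s * p \<le> s * inner (x - xs) g"
    using assms by (intro mult_left_mono) (auto simp: s_def)
  moreover have "s * p = \<theta> * (p / norm g)\<^sup>2" "s\<^sup>2 * (norm g)\<^sup>2 = \<theta>\<^sup>2 * (p / norm g)\<^sup>2"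
    using assms(1) by (simp_all add: s_def field_simps power2_eq_square)
  moreover have "\<theta> * (2 - \<theta>) * (p / norm g)\<^sup>2
      = 2 * (\<theta> * (p / norm g)\<^sup>2) - \<theta>\<^sup>2 * (p / norm g)\<^sup>2"
    by (simp add: left_diff_distrib right_diff_distrib power2_eq_square[of \<theta>])
  ultimately show ?thesis
    unfolding s_def[symmetric] by linarith
qed

theorem proposition4p2:
  fixes F :: "'a::{real_inner,complete_space} \<Rightarrow> 'b::{real_inner,complete_space}"
    and F' :: "'a \<Rightarrow> 'a \<Rightarrow>\<^sub>L 'b"
    and D :: "'a set"
    and x0 xk xk1 :: 'a
    and y yd :: 'b
    and C \<rho> \<eta> \<delta> \<tau> \<theta> :: real
  assumes A1_cont: "continuous_on D F"
    and A1_interior: "interior D \<noteq> {}"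
    and A1_const: "C > 0" "\<rho> > 0"
    and A1_ball: "x0 \<in> D" "ball x0 \<rho> \<subseteq> D"
    and A1_deriv: "\<forall>x\<in>ball x0 \<rho>. has_gateaux_derivative F (F' x) x \<and> norm (F' x) \<le> C"
    and A2_const: "0 \<le> \<eta>" "\<eta> < 1"
    and A2: "\<forall>x\<in>ball x0 \<rho>. \<forall>xbar\<in>ball x0 \<rho>.
      norm (F xbar - F x - blinfun_apply (F' x) (xbar - x)) \<le> \<eta> * norm (F xbar - F x)"
    and A3: "\<exists>xs\<in>ball x0 (\<rho> / 2). F xs = y"
    and delta: "\<delta> > 0"
    and noise: "norm (yd - y) \<le> \<delta>"
    and tau: "\<tau> > (1 + \<eta>) / (1 - \<eta>)"
    and theta: "0 < \<theta>" "\<theta> < 2"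
    and xk: "xk \<in> ball x0 \<rho>"
    and discrepancy: "norm (residual F yd xk) > \<tau> * \<delta>"
    and xk1: "xk1 = xk - (\<theta> * (p_poly \<eta> \<delta> (norm (residual F yd xk)) /
      (norm (adj_residual F F' yd xk))\<^sup>2)) *\<^sub>R adj_residual F F' yd xk"
  shows "adj_residual F F' yd xk \<noteq> 0 \<and>
    (\<forall>xs \<in> ball x0 \<rho> \<inter> {x \<in> D. F x = y}.
      (norm (xs - xk))\<^sup>2 \<ge> (norm (xs - xk1))\<^sup>2 +
        \<theta> * (2 - \<theta>) *
        (p_poly \<eta> \<delta> (norm (residual F yd xk)) / norm (adj_residual F F' yd xk))\<^sup>2)"
proof -
  define p where "p = p_poly \<eta> \<delta> (norm (residual F yd xk))"
  define g where "g = adj_residual F F' yd xk"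
  have "0 < p"
    unfolding p_def using A2_const delta tau discrepancy by (intro p_poly_pos)
  have lower: "p \<le> inner (xk - xs) g" if "xs \<in> ball x0 \<rho>" "F xs = y" for xs
    unfolding p_def g_def using A2 xk that noise A2_const
    by (intro p_poly_le_inner_adj_residual) auto
  \<comment> \<open>One solution in the ball suffices to exclude \<open>g = 0\<close>, since its
    inner product with \<open>g\<close> would then vanish instead of being at least
    \<open>p > 0\<close>.\<close>
  obtain xs where "xs \<in> ball x0 (\<rho> / 2)" "F xs = y"
    using A3 by blast
  then have "p \<le> inner (xk - xs) g"
    using A1_const by (intro lower) auto
  with \<open>0 < p\<close> have "g \<noteq> 0" by auto
  moreover have "(norm (xs - xk1))\<^sup>2 + \<theta> * (2 - \<theta>) * (p / norm g)\<^sup>2 \<le> (norm (xs - xk))\<^sup>2"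
    if "xs \<in> ball x0 \<rho>" "F xs = y" for xs
    using relaxed_projection_decrease[OF \<open>g \<noteq> 0\<close> _ lower[OF that], of \<theta>] \<open>0 < p\<close> theta
    by (simp add: xk1 p_def g_def)
  ultimately show ?thesis by (auto simp: p_def g_def)
qed

end
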